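(* There are absolute constants $c>0$ and $C\ge1$ such that for all integers $k\ge2$ and $n,U\ge Ck$, every deterministic streaming algorithm computing $\mathsf{HeavyHitters}[n,U,k]$ uses at least $c\,k\left(\log(n/k)+\log(U/k)\right)$ bits of space.
   Context: $\mathsf{HeavyHitters}[n,U,k]$: given an input string $x\in[U]^n$, output a list of $k$ elements $u_1,\dots,u_k\in[U]$ such that every element of $[U]$ appearing at least $n/k$ times in $x$ belongs to $\{u_1,\dots,u_k\}$, together with reals $\tilde f_1,\dots,\tilde f_k$ such that $f_i-n/k\le\tilde f_i\le f_i$, where $f_i$ is the number of occurrences of $u_i$ in $x$; the algorithm must produce a valid output on every input (deterministic, worst case). A deterministic streaming algorithm using $s$ bits of space reads $x_1,\dots,x_n$ one symbol at a time; after each prefix it is in one of at most $2^s$ memory states, the next state is an arbitrary function of the time index, current state and next symbol, and the output is an arbitrary function of the final state. (The paper's hypothesis is $\min\{n,U\}\gg k\ge2$, i.e. $\min\{n,U\}/k$ sufficiently large, formalized here by the constant $C$.) *)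

theory Defs
  imports Complex_Main
begin

text \<open>
  Streaming algorithms over an alphabet of natural numbers.  Memory states are labelled by natural
  numbers; since the state space is finite this is no restriction, and it keeps the algorithm type
  free of type variables, so that absolute constants cannot depend on the type of states.
  The output is a list of symbols together with a list of frequency estimates.
\<close>

record stream_alg =
  states :: "nat set"
  init :: nat
  trans_fn :: "nat \<Rightarrow> nat \<Rightarrow> nat \<Rightarrow> nat"  \<comment> \<open>time index, current state, next symbol\<close>
  out_fn :: "nat \<Rightarrow> nat list \<times> real list"

definition alphabet :: "nat \<Rightarrow> nat set" where
  "alphabet U = {1..U}"

definition inputs :: "nat \<Rightarrow> nat \<Rightarrow> nat list set" where
  "inputs n U = {x. length x = n \<and> set x \<subseteq> alphabet U}"

definition streaming_algorithm :: "nat \<Rightarrow> nat \<Rightarrow> stream_alg \<Rightarrow> bool" where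
  "streaming_algorithm n U A \<longleftrightarrow>
     finite (states A) \<and> init A \<in> states A \<and>
     (\<forall>t\<in>{1..n}. \<forall>q\<in>states A. \<forall>a\<in>alphabet U. trans_fn A t q a \<in> states A)"

definition uses_space :: "stream_alg \<Rightarrow> nat \<Rightarrow> bool" where
  "uses_space A s \<longleftrightarrow> card (states A) \<le> 2 ^ s"

text \<open>
  \<open>state_after A x t\<close> is the state after the first \<open>t\<close> symbols of \<open>x\<close>; lists are
  indexed from 0, so the symbol read at time \<open>Suc t\<close> is \<open>x ! t\<close>.
\<close>

primrec state_after :: "stream_alg \<Rightarrow> nat list \<Rightarrow> nat \<Rightarrow> nat" where
  "state_after A x 0 = init A"
| "state_after A x (Suc t) = trans_fn A (Suc t) (state_after A x t) (x ! t)"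

definition alg_output :: "stream_alg \<Rightarrow> nat list \<Rightarrow> nat list \<times> real list" where
  "alg_output A x = out_fn A (state_after A x (length x))"

text \<open>The reported symbols are not required to be distinct.\<close>

definition heavy_hitters_valid ::
    "nat \<Rightarrow> nat \<Rightarrow> nat \<Rightarrow> nat list \<Rightarrow> nat list \<times> real list \<Rightarrow> bool" where
  "heavy_hitters_valid n U k x = (\<lambda>(us, fs).
     length us = k \<and> length fs = k \<and> set us \<subseteq> alphabet U \<and>
     (\<forall>v\<in>alphabet U. real (count_list x v) \<ge> real n / real k \<longrightarrow> v \<in> set us) \<and>
     (\<forall>i<k. real (count_list x (us ! i)) - real n / real k \<le> fs ! i \<and>
            fs ! i \<le> real (count_list x (us ! i))))"

definition computes_heavy_hitters :: "stream_alg \<Rightarrow> nat \<Rightarrow> nat \<Rightarrow> nat \<Rightarrow> bool" where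
  "computes_heavy_hitters A n U k \<longleftrightarrow>
     (\<forall>x\<in>inputs n U. heavy_hitters_valid n U k x (alg_output A x))"

end

theory Submission
  imports Defs "HOL-Library.FuncSet"
begin

text \<open>
  For a state \<open>q\<close> reached at time \<open>t\<close> let \<open>low q \<in> \<nat>\<^sup>B\<close> record, for each
  symbol of a set \<open>B\<close>, the least number of its occurrences in a string over \<open>B\<close> leading to \<open>q\<close>.
  Fix a vector \<open>u\<close> of small total.  As long as the current state has \<open>low q \<le> u\<close> but
  \<open>low q \<noteq> u\<close>, feeding a symbol where the two differ preserves \<open>low q \<le> u\<close>.  At time \<open>n\<close> the
  accuracy of the estimates forces the total of \<open>low q\<close> to be at least \<open>n / 2\<close> when \<open>|B|\<close> is about
  \<open>k / 2\<close>, so \<open>u\<close> must equal \<open>low q\<close> at some earlier time.  Hence all \<open>(n / (2|B|)) ^ |B|\<close> vectors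
  of a box are among the at most \<open>n 2 ^ s\<close> vectors \<open>low q\<close>.  The term \<open>log (U / k)\<close> comes from
  counting the sets of \<open>k / 2\<close> symbols that can be simultaneously heavy: each output list
  contains at most \<open>2 ^ k\<close> of them.
\<close>

section \<open>Runs of the algorithm\<close>

lemma state_after_append:
  "t \<le> length x \<Longrightarrow> state_after A (x @ y) t = state_after A x t"
  by (induction t) (auto simp: nth_append)

lemma state_after_snoc:
  "length x = t \<Longrightarrow> state_after A (x @ [a]) (Suc t) = trans_fn A (Suc t) (state_after A x t) a"
  by (auto simp: state_after_append nth_append)

lemma state_after_in_states:
  assumes "streaming_algorithm n U A" "length x \<le> n" "set x \<subseteq> alphabet U" "t \<le> length x"
  shows "state_after A x t \<in> states A"
  using assms(4)
proof (induction t)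
  case 0
  then show ?case using assms(1) by (simp add: streaming_algorithm_def)
next
  case (Suc t)
  then have "x ! t \<in> alphabet U" using assms(3) by (meson Suc_le_lessD nth_mem subsetD)
  moreover have "Suc t \<in> {1..n}" using Suc.prems assms(2) by auto
  ultimately show ?case using Suc assms(1) by (auto simp: streaming_algorithm_def)
qed

section \<open>Coordinatewise minimal counts and the adaptive adversary\<close>

definition reaching :: "stream_alg \<Rightarrow> nat set \<Rightarrow> nat \<Rightarrow> nat \<Rightarrow> nat list set" where
  "reaching A B t q = {x. length x = t \<and> set x \<subseteq> B \<and> state_after A x t = q}"

text \<open>Each symbol has its own minimum, so no single string need attain all of them. If no
  string over \<open>B\<close> reaches \<open>q\<close> at time \<open>t\<close>, the value is
  unspecified.\<close>

definition low :: "stream_alg \<Rightarrow> nat set \<Rightarrow> nat \<Rightarrow> nat \<Rightarrow> nat \<Rightarrow> nat" where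
  "low A B t q j = (LEAST c. \<exists>x\<in>reaching A B t q. count_list x j = c)"

lemma low_le: "x \<in> reaching A B t q \<Longrightarrow> low A B t q j \<le> count_list x j"
  unfolding low_def by (rule Least_le) blast

lemma low_attained:
  assumes "x \<in> reaching A B t q"
  obtains y where "y \<in> reaching A B t q" "count_list y j = low A B t q j"
proof -
  have "\<exists>y\<in>reaching A B t q. count_list y j = low A B t q j"
    unfolding low_def by (rule LeastI_ex) (use assms in blast)
  then show thesis using that by blast
qed

text \<open>Append \<open>a\<close> to a string that minimizes the count of \<open>j\<close>. The
  inequality can be strict, since other strings may lead to the new state too.\<close>

lemma low_step:
  assumes "x \<in> reaching A B t q" "a \<in> B"
  shows "low A B (Suc t) (trans_fn A (Suc t) q a) j \<le> low A B t q j + (if j = a then 1 else 0)"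
proof -
  obtain y where y: "y \<in> reaching A B t q" "count_list y j = low A B t q j"
    using low_attained[OF assms(1)] .
  have "y @ [a] \<in> reaching A B (Suc t) (trans_fn A (Suc t) q a)"
    using y(1) assms(2) state_after_snoc[of y t A a] by (auto simp: reaching_def)
  from low_le[OF this, of j] y(2) show ?thesis by (auto split: if_splits)
qed

text \<open>The next symbol depends on the current state. Where the vectors differ,
  \<open>low\<close> is strictly below \<open>u\<close>, which leaves room for the increment; by
  \<open>low_step\<close> no other coordinate grows.\<close>

lemma low_hits_or_stays_below:
  assumes "\<And>t x. t < n \<Longrightarrow> length x = t \<Longrightarrow> set x \<subseteq> B \<Longrightarrow>
             \<exists>j\<in>B. low A B t (state_after A x t) j \<noteq> u j"
    and "t \<le> n"
  shows "\<exists>x. length x = t \<and> set x \<subseteq> B \<and> (\<forall>j\<in>B. low A B t (state_after A x t) j \<le> u j)"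
  using assms(2)
proof (induction t)
  case 0
  have "[] \<in> reaching A B 0 (init A)" by (simp add: reaching_def)
  from low_le[OF this] have "low A B 0 (init A) j = 0" for j by (metis count_list.simps(1) le_zero_eq)
  then show ?case by simp
next
  case (Suc t)
  then obtain x where x: "length x = t" "set x \<subseteq> B"
    and le: "\<forall>j\<in>B. low A B t (state_after A x t) j \<le> u j" by auto
  obtain a where a: "a \<in> B" "low A B t (state_after A x t) a \<noteq> u a"
    using assms(1) Suc.prems x by (metis Suc_le_lessD)
  have "x \<in> reaching A B t (state_after A x t)" using x by (simp add: reaching_def)
  note step = low_step[OF this a(1)]
  have "low A B (Suc t) (state_after A (x @ [a]) (Suc t)) j \<le> u j" if "j \<in> B" for j
    using step[of j] le a that state_after_snoc[OF x(1), of A a]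
    by (cases "j = a") (auto intro: le_trans dest!: bspec[of _ _ j] simp: le_less)
  then show ?case using x a(1) by (intro exI[of _ "x @ [a]"]) auto
qed

text \<open>By \<open>final\<close>, no box vector bounds \<open>low\<close> at time
  \<open>n\<close>, so each equals \<open>low\<close> at an earlier time. The factor
  \<open>n\<close> counts the times: one state label may carry different vectors at different
  times.\<close>

lemma card_box_le:
  assumes alg: "streaming_algorithm n U A" and B: "finite B" "B \<subseteq> alphabet U"
    and final: "\<And>x u. length x = n \<Longrightarrow> set x \<subseteq> B \<Longrightarrow> u \<in> B \<rightarrow>\<^sub>E {..<b} \<Longrightarrow>
                  \<exists>j\<in>B. low A B n (state_after A x n) j > u j"
  shows "b ^ card B \<le> n * card (states A)"
proof -
  have fin: "finite (states A)" using alg by (simp add: streaming_algorithm_def)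
  let ?f = "\<lambda>(t, q). restrict (low A B t q) B"
  have "(B \<rightarrow>\<^sub>E {..<b}) \<subseteq> ?f ` ({..<n} \<times> states A)"
  proof
    fix u assume u: "u \<in> B \<rightarrow>\<^sub>E {..<b}"
    have "\<exists>t<n. \<exists>x. length x = t \<and> set x \<subseteq> B \<and> (\<forall>j\<in>B. low A B t (state_after A x t) j = u j)"
    proof (rule ccontr)
      assume "\<not> ?thesis"
      then obtain x where x: "length x = n" "set x \<subseteq> B"
          and le: "\<forall>j\<in>B. low A B n (state_after A x n) j \<le> u j"
        using low_hits_or_stays_below[of n B A u n] by blast
      from final[OF x u] le show False by (auto simp: not_le[symmetric])
    qed
    then obtain t x where tx: "t < n" "length x = t" "set x \<subseteq> B"
      and eq: "\<forall>j\<in>B. low A B t (state_after A x t) j = u j" by blast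
    have "state_after A x t \<in> states A"
      using state_after_in_states[OF alg, of x t] tx B(2) by auto
    \<comment> \<open>\<open>u\<close> is extensional, so both sides are \<open>undefined\<close>
      off \<open>B\<close>.\<close>
    moreover have "u = restrict (low A B t (state_after A x t)) B"
    proof
      fix j show "u j = restrict (low A B t (state_after A x t)) B j"
        using eq PiE_arb[OF u, of j] by (cases "j \<in> B") simp_all
    qed
    ultimately show "u \<in> ?f ` ({..<n} \<times> states A)"
      using tx(1) by (auto intro!: image_eqI[of _ _ "(t, state_after A x t)"])
  qed
  then have "card (B \<rightarrow>\<^sub>E {..<b}) \<le> card (?f ` ({..<n} \<times> states A))"
    by (rule card_mono[rotated]) (use fin in auto)
  also have "\<dots> \<le> card ({..<n} \<times> states A)" by (rule card_image_le) (use fin in auto)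
  finally show ?thesis using B(1) by (simp add: card_PiE card_cartesian_product)
qed

section \<open>Consequences of accurate estimates\<close>

text \<open>Both strings receive the same output. If \<open>v\<close> is listed, its common estimate
  lies between the two sides; otherwise \<open>v\<close> is not heavy in \<open>x\<close> and the
  left side is negative.\<close>

lemma count_le_count_same_state:
  assumes "computes_heavy_hitters A n U k" "x \<in> inputs n U" "y \<in> inputs n U"
    and "state_after A x n = state_after A y n" "v \<in> alphabet U"
  shows "real (count_list x v) - real n / real k \<le> real (count_list y v)"
proof -
  obtain us fs where o: "alg_output A x = (us, fs)" by fastforce
  then have o': "alg_output A y = (us, fs)"
    using assms(2-4) by (simp add: alg_output_def inputs_def)
  have vx: "heavy_hitters_valid n U k x (us, fs)" and vy: "heavy_hitters_valid n U k y (us, fs)"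
    using assms(1-3) unfolding computes_heavy_hitters_def
    by (metis o, metis o')
  show ?thesis
  proof (cases "v \<in> set us")
    case True
    then obtain i where "i < k" "us ! i = v"
      using vx by (auto simp: heavy_hitters_valid_def in_set_conv_nth)
    then show ?thesis using vx vy by (fastforce simp: heavy_hitters_valid_def)
  next
    case False
    then show ?thesis using vx assms(5) by (force simp: heavy_hitters_valid_def)
  qed
qed

lemma length_eq_sum_count_list:
  "finite B \<Longrightarrow> set x \<subseteq> B \<Longrightarrow> (\<Sum>j\<in>B. count_list x j) = length x"
  by (metis sum_count_set)

lemma sum_low_ge:
  assumes comp: "computes_heavy_hitters A n U k"
    and B: "finite B" "B \<noteq> {}" "B \<subseteq> alphabet U" and x: "length x = n" "set x \<subseteq> B"
  shows "(\<Sum>j\<in>B. real (low A B n (state_after A x n) j)) \<ge> real n - (real (card B) - 1) * (real n / real k)"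
proof -
  let ?q = "state_after A x n"
  let ?d = "real n / real k"
  obtain a where a: "a \<in> B" using B by blast
  have x_reach: "x \<in> reaching A B n ?q" using x by (simp add: reaching_def)
  have inputs: "y \<in> inputs n U" if "y \<in> reaching A B n ?q" for y
    using that B by (auto simp: reaching_def inputs_def)
  \<comment> \<open>Using a string that attains the minimum at \<open>a\<close> saves one error term; this matters for \<open>k = 2\<close>.\<close>
  obtain y where y: "y \<in> reaching A B n ?q" "count_list y a = low A B n ?q a"
    using low_attained[OF x_reach] .
  have le: "real (count_list y j) - ?d \<le> real (low A B n ?q j)" if j: "j \<in> B" for j
  proof -
    obtain z where z: "z \<in> reaching A B n ?q" "count_list z j = low A B n ?q j"
      using low_attained[OF x_reach] .
    have "state_after A y n = state_after A z n" using y z by (simp add: reaching_def)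
    from count_le_count_same_state[OF comp inputs[OF y(1)] inputs[OF z(1)] this] j B(3)
    show ?thesis unfolding z(2)[symmetric] by blast
  qed
  have "real n = (\<Sum>j\<in>B. real (count_list y j))"
    using length_eq_sum_count_list[of B y] y(1) B(1) by (simp add: reaching_def flip: of_nat_sum)
  also have "\<dots> = real (count_list y a) + (\<Sum>j\<in>B - {a}. real (count_list y j))"
    using B a by (simp add: sum.remove)
  also have "\<dots> \<le> real (low A B n ?q a) + (\<Sum>j\<in>B - {a}. real (low A B n ?q j) + ?d)"
    using le y(2) by (intro add_mono sum_mono) (auto simp: algebra_simps)
  also have "\<dots> = (\<Sum>j\<in>B. real (low A B n ?q j)) + real (card B - 1) * ?d"
    using B a by (simp add: sum.distrib sum.remove[of B a] card_Diff_singleton)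
  also have "real (card B - 1) = real (card B) - 1"
    using B by (simp add: of_nat_diff Suc_leI card_gt_0_iff)
  finally show ?thesis by simp
qed

text \<open>Since \<open>m - 1 <= k / 2\<close>, the loss in \<open>sum_low_ge\<close> is at most
  \<open>n / 2\<close>, so \<open>low\<close> totals at least \<open>n / 2\<close> at the end;
  \<open>m\<close> entries below \<open>n / (2 * m)\<close> total less.\<close>

lemma length_states_bound:
  assumes alg: "streaming_algorithm n U A" and comp: "computes_heavy_hitters A n U k"
    and k: "k \<ge> 2" "k \<le> U" and m: "m = k div 2 + 1"
  shows "(real n / (2 * real m)) ^ m \<le> real n * real (card (states A))"
proof -
  \<comment> \<open>A natural number is below the ceiling \<open>b\<close> exactly when it is below
    \<open>n / (2 * m)\<close>, so rounding up loses nothing on either side.\<close>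
  define b where "b = nat \<lceil>real n / (2 * real m)\<rceil>"
  have mk: "m \<le> k" "m \<ge> 1" "real m - 1 \<le> real k / 2" using k m by linarith+
  define B where "B = {1..m}"
  have B: "finite B" "B \<noteq> {}" "B \<subseteq> alphabet U" "card B = m"
    using mk k by (auto simp: B_def alphabet_def)
  have "b ^ card B \<le> n * card (states A)"
  proof (rule card_box_le[OF alg B(1,3)])
    fix x u assume x: "length x = n" "set x \<subseteq> B" and u: "u \<in> B \<rightarrow>\<^sub>E {..<b}"
    show "\<exists>j\<in>B. low A B n (state_after A x n) j > u j"
    proof (rule ccontr)
      assume "\<not> ?thesis"
      then have "(\<Sum>j\<in>B. real (low A B n (state_after A x n) j)) \<le> (\<Sum>j\<in>B. real (u j))"
        by (intro sum_mono) (auto simp: not_less)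
      also have "\<dots> < (\<Sum>j\<in>B. real n / (2 * real m))"
      proof (rule sum_strict_mono)
        fix j assume "j \<in> B"
        then have "u j < b" using u by auto
        then show "real (u j) < real n / (2 * real m)" unfolding b_def by linarith
      qed (use B in auto)
      also have "\<dots> = real n / 2" using B mk by simp
      also have "\<dots> \<le> real n - (real m - 1) * (real n / real k)"
      proof -
        have "(real m - 1) * (real n / real k) \<le> (real k / 2) * (real n / real k)"
          using mk by (intro mult_right_mono) auto
        then show ?thesis using k by simp
      qed
      finally show False using sum_low_ge[OF comp B(1-3) x] B(4) by simp
    qed
  qed
  then have "real b ^ m \<le> real n * real (card (states A))"
    using B(4) by (metis of_nat_le_iff of_nat_mult of_nat_power)
  moreover have "(real n / (2 * real m)) ^ m \<le> real b ^ m"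
    unfolding b_def by (intro power_mono) (auto simp: real_nat_ceiling_ge)
  ultimately show ?thesis by linarith
qed

section \<open>Counting sets of simultaneously heavy symbols\<close>

lemma exists_list_with_counts:
  assumes "finite H"
  shows "\<exists>x. length x = q * card H \<and> set x \<subseteq> H \<and> (\<forall>v\<in>H. count_list x v \<ge> q)"
  using assms
proof (induction H)
  case empty
  then show ?case by simp
next
  case (insert a H)
  then obtain x where "length x = q * card H" "set x \<subseteq> H" "\<forall>v\<in>H. count_list x v \<ge> q" by blast
  moreover have "count_list (replicate q a) a = q" by (induction q) auto
  ultimately show ?case using insert.hyps
    by (intro exI[of _ "replicate q a @ x"]) auto
qed

lemma exists_heavy_input:
  assumes "finite H" "H \<subseteq> alphabet U" "card H = h" "h \<ge> 1" "2 * h \<le> k" "k \<le> n"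
  shows "\<exists>x\<in>inputs n U. \<forall>v\<in>H. real (count_list x v) \<ge> real n / real k"
proof -
  obtain x where x: "length x = (n div h) * h" "set x \<subseteq> H" "\<forall>v\<in>H. count_list x v \<ge> n div h"
    using exists_list_with_counts[OF assms(1), of "n div h"] assms(3) by auto
  obtain a where a: "a \<in> H" using assms by fastforce
  have "n div h * h + n mod h = n" by simp
  then have "x @ replicate (n mod h) a \<in> inputs n U"
    using x a assms(2) by (auto simp: inputs_def set_replicate_conv_if)
  moreover have "real n / real k \<le> real (n div h)"
  proof -
    have "n < (n div h + 1) * h"
      using assms(4) by (metis add.commute dividend_less_div_times less_le_trans less_one mult_Suc
          not_le plus_1_eq_Suc zero_less_iff_neq_zero)
    \<comment> \<open>The slack in \<open>2 * h <= k\<close> absorbs the rounding: with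
      \<open>q = n div h\<close>, \<open>2 * n <= (q + 1) * k <= q * k + n\<close>.\<close>
    then have "2 * n \<le> (n div h + 1) * (2 * h)" by simp
    also have "\<dots> \<le> (n div h + 1) * k" using assms(5) by (intro mult_le_mono) auto
    finally have "n \<le> (n div h) * k" using assms(6) by (simp add: algebra_simps)
    then have "real n \<le> real (n div h) * real k" by (metis of_nat_le_iff of_nat_mult)
    then show ?thesis using assms by (simp add: divide_le_eq)
  qed
  moreover have "real (count_list (x @ replicate (n mod h) a) v) \<ge> real (n div h)" if "v \<in> H" for v
    using x(3) that by (simp add: trans_le_add1 flip: of_nat_add)
  ultimately show ?thesis by (meson order_trans)
qed

text \<open>For each \<open>h\<close>-set take an input in which all its symbols are heavy. The list
  at the final state contains the set, so one state serves at most \<open>2 ^ k\<close>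
  sets.\<close>

lemma alphabet_states_bound:
  assumes alg: "streaming_algorithm n U A" and comp: "computes_heavy_hitters A n U k"
    and h: "h \<ge> 1" "2 * h \<le> k" and "k \<le> n"
  shows "U choose h \<le> card (states A) * 2 ^ k"
proof -
  have fin: "finite (states A)" using alg by (simp add: streaming_algorithm_def)
  have finU: "finite (alphabet U)" "card (alphabet U) = U" by (auto simp: alphabet_def)
  define F where "F = {H. H \<subseteq> alphabet U \<and> card H = h}"
  have "\<forall>H\<in>F. \<exists>x\<in>inputs n U. \<forall>v\<in>H. real (count_list x v) \<ge> real n / real k"
    using exists_heavy_input[OF _ _ _ h assms(5)] finite_subset[OF _ finU(1)]
    by (auto simp: F_def)
  then obtain X where X: "\<forall>H\<in>F. X H \<in> inputs n U \<and> (\<forall>v\<in>H. real (count_list (X H) v) \<ge> real n / real k)"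
    by metis
  define us where "us q = fst (out_fn A q)" for q
  \<comment> \<open>Validity controls the list length only at states that are reached; the empty
    family keeps the bound \<open>2 ^ k\<close> at all others.\<close>
  let ?P = "\<lambda>q. if length (us q) = k then Pow (set (us q)) else {}"
  have "F \<subseteq> (\<Union>q\<in>states A. ?P q)"
  proof
    fix H assume H: "H \<in> F"
    let ?q = "state_after A (X H) n"
    have in_inputs: "X H \<in> inputs n U" using X H by blast
    then have "?q \<in> states A"
      using state_after_in_states[OF alg, of "X H" n] by (auto simp: inputs_def)
    moreover have "heavy_hitters_valid n U k (X H) (out_fn A ?q)"
      using comp in_inputs by (auto simp: computes_heavy_hitters_def alg_output_def inputs_def)
    then have "length (us ?q) = k"
      and "\<And>v. v \<in> alphabet U \<Longrightarrow> real (count_list (X H) v) \<ge> real n / real k \<Longrightarrow> v \<in> set (us ?q)"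
      by (auto simp: heavy_hitters_valid_def us_def split: prod.splits)
    moreover from this(2) have "H \<subseteq> set (us ?q)" using X H by (auto simp: F_def)
    ultimately show "H \<in> (\<Union>q\<in>states A. ?P q)" by force
  qed
  then have "card F \<le> card (\<Union>q\<in>states A. ?P q)"
    by (rule card_mono[rotated]) (use fin in auto)
  also have "\<dots> \<le> (\<Sum>q\<in>states A. card (?P q))" by (rule card_UN_le[OF fin])
  also have "\<dots> \<le> (\<Sum>q\<in>states A. 2 ^ k)"
    by (rule sum_mono) (auto simp: card_Pow intro!: power_increasing card_length)
  finally show ?thesis using n_subsets[OF finU(1), of h] finU(2) by (simp add: F_def)
qed

section \<open>Passage to logarithms and choice of constants\<close>

lemma space_ge_log_length:
  assumes alg: "streaming_algorithm n U A" and comp: "computes_heavy_hitters A n U k"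
    and "uses_space A s" and k: "k \<ge> 2" "k \<le> U" and n: "real n \<ge> 2 ^ 16 * real k"
  shows "real s \<ge> real k / 8 * log 2 (real n / real k)"
proof -
  define m where "m = k div 2 + 1"
  define N where "N = real n / real k"
  have m: "m \<le> k" "m \<ge> 1" "real m - 1 \<ge> real k / 4" using k by (simp_all add: m_def)
  have N: "N \<ge> 2 ^ 16" "N > 0" "real n = N * real k"
    using n k by (auto simp: N_def field_simps)
  have logN: "log 2 N \<ge> 16" using N by (simp add: le_log_iff powr_realpow[symmetric])
  have "(N / 2) ^ m \<le> (real n / (2 * real m)) ^ m"
    using m N by (intro power_mono) (auto simp: field_simps mult_left_mono)
  also have "\<dots> \<le> real n * real (card (states A))"
    by (rule length_states_bound[OF alg comp k m_def])
  also have "\<dots> \<le> real n * 2 ^ s"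
    using assms(3) by (intro mult_left_mono) (auto simp: uses_space_def simp flip: of_nat_le_iff)
  finally have "log 2 ((N / 2) ^ m) \<le> log 2 (N * real k * 2 ^ s)"
    using N k by (simp add: log_le_cancel_iff)
  \<comment> \<open>The time factor \<open>n = N * k\<close> costs one \<open>log 2 N\<close>,
    leaving \<open>m - 1\<close> of them, still positive at \<open>k = 2\<close>. The other losses,
    \<open>m + log 2 k <= 2 * k\<close>, are at most half of \<open>k / 4 * log 2 N\<close> because
    \<open>log 2 N >= 16\<close>.\<close>
  then have "real m * (log 2 N - 1) \<le> log 2 N + log 2 (real k) + real s"
    using N k by (simp add: log_nat_power log_divide log_mult)
  moreover have "log 2 (real k) \<le> real k"
    using k less_exp[of k] by (simp add: log_le_iff powr_realpow)
  moreover have "(real m - 1) * log 2 N \<ge> real k / 4 * log 2 N"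
    using m logN by (intro mult_right_mono) auto
  moreover have "real k / 8 * log 2 N \<ge> real k / 8 * 16"
    using logN by (intro mult_left_mono) auto
  ultimately show ?thesis using m(1) unfolding N_def by (simp add: algebra_simps)
qed

lemma space_ge_log_alphabet:
  assumes alg: "streaming_algorithm n U A" and comp: "computes_heavy_hitters A n U k"
    and "uses_space A s" and k: "k \<ge> 2" "k \<le> n" and U: "real U \<ge> 2 ^ 6 * real k"
  shows "real s \<ge> real k / 6 * log 2 (real U / real k)"
proof -
  define h where "h = k div 2"
  define V where "V = real U / real k"
  have h: "h \<ge> 1" "2 * h \<le> k" "real h \<ge> real k / 3" 
  proof -
    \<comment> \<open>Equality at \<open>k = 3\<close> dictates the constant 1/3.\<close>
    have "k \<le> 3 * (k div 2)" using k by presburger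
    then have "real k \<le> real (3 * (k div 2))" by (rule of_nat_mono)
    then show "real h \<ge> real k / 3" by (simp add: h_def)
  qed (use k in \<open>simp_all add: h_def\<close>)
  have V: "V \<ge> 2 ^ 6" "V > 0" using U k by (auto simp: V_def field_simps)
  have logV: "log 2 V \<ge> 6" using V by (simp add: le_log_iff powr_realpow[symmetric])
  have "h \<le> U" using U h(2) by simp
  have "V ^ h \<le> (real U / real h) ^ h"
    using h by (auto simp: V_def intro!: power_mono divide_left_mono)
  also have "\<dots> \<le> real (U choose h)"
    using binomial_ge_n_over_k_pow_k[OF \<open>h \<le> U\<close>, where 'a = real] by simp
  also have "\<dots> \<le> real (card (states A) * 2 ^ k)"
    using alphabet_states_bound[OF alg comp h(1,2) k(2)] by (simp only: of_nat_le_iff)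
  also have "\<dots> \<le> 2 ^ s * 2 ^ k"
    using assms(3) by (auto simp: uses_space_def simp flip: of_nat_le_iff)
  finally have "log 2 (V ^ h) \<le> log 2 (2 ^ s * 2 ^ k)"
    using V by (simp add: log_le_cancel_iff)
  \<comment> \<open>The loss \<open>k\<close> is at most half of \<open>k / 3 * log 2 V\<close>
    because \<open>log 2 V >= 6\<close>.\<close>
  then have "real h * log 2 V \<le> real s + real k"
    using V by (simp add: log_nat_power log_mult)
  moreover have "real h * log 2 V \<ge> real k / 3 * log 2 V"
    using h logV by (intro mult_right_mono) auto
  moreover have "real k / 6 * log 2 V \<ge> real k / 6 * 6"
    using logV by (intro mult_left_mono) auto
  ultimately show ?thesis unfolding V_def by (simp add: algebra_simps)
qed

theorem theorem7p2:
  "\<exists>c C :: real. c > 0 \<and> C \<ge> 1 \<and>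
     (\<forall>(k::nat) (n::nat) (U::nat) (A::stream_alg) (s::nat).
        k \<ge> 2 \<longrightarrow> real n \<ge> C * real k \<longrightarrow> real U \<ge> C * real k \<longrightarrow>
        streaming_algorithm n U A \<longrightarrow> computes_heavy_hitters A n U k \<longrightarrow> uses_space A s \<longrightarrow>
        real s \<ge> c * real k * (log 2 (real n / real k) + log 2 (real U / real k)))"
proof (rule exI[of _ "1/16"], rule exI[of _ "2 ^ 16"], intro conjI allI impI)
  fix k n U A s
  assume k: "k \<ge> 2" and n: "real n \<ge> 2 ^ 16 * real k" and U: "real U \<ge> 2 ^ 16 * real k"
    and alg: "streaming_algorithm n U A" and comp: "computes_heavy_hitters A n U k"
    and space: "uses_space A s"
  have "k \<le> n" "k \<le> U" "real U \<ge> 2 ^ 6 * real k" using n U by simp_all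
  then have "real s \<ge> real k / 8 * log 2 (real n / real k)"
    and s2: "real s \<ge> real k / 6 * log 2 (real U / real k)"
    using space_ge_log_length[OF alg comp space k _ n] space_ge_log_alphabet[OF alg comp space k]
    by auto
  \<comment> \<open>With 1/8 in both bounds, their average gives 1/16.\<close>
  moreover have "real k / 6 * log 2 (real U / real k) \<ge> real k / 8 * log 2 (real U / real k)"
    using U k by (intro mult_right_mono) (auto simp: field_simps)
  ultimately show "real s \<ge> 1/16 * real k * (log 2 (real n / real k) + log 2 (real U / real k))"
    by (simp add: algebra_simps)
qed auto

end
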